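(* Let $\rho>0$. There exist $\Gamma_0>0$ and constants $u_0$, $c_0>0$, $a_0$, depending only on $\rho$ (in particular not on $\Gamma$), such that the following holds. Let $\{Z(\iota)\}_{\iota\in\mathcal I}$ be a (zero mean) standard subGaussian process over an index set $\mathcal I$ with canonical distance $d_Z$, and suppose that for some $\Gamma\ge\Gamma_0$ the metric space $(\mathcal I,d_Z)$ has $\epsilon$-covering numbers satisfying $$\mathcal N(\mathcal I,d_Z,\epsilon)\le \Gamma\,\epsilon^{-\rho}\qquad\text{for all } 0<\epsilon\le 1 .$$ Then for all $u>u_0$, $$\mathbb P\left\{\sqrt{c_0\log\Gamma}\left(\sup_{\iota\in\mathcal I}Z(\iota)-\sqrt{2\log\Gamma}\right)-a_0\log\log\Gamma>u\right\}\le e^{-u}.$$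
   Context: A random field $\{Z(\iota)\}_{\iota\in\mathcal I}$ is a (zero mean) standard subGaussian process if there exists a constant $\bar u_0>0$ such that for all $\iota_0,\iota_1\in\mathcal I$ and all $u>\bar u_0$, $$\mathbb P\{|Z(\iota_0)-Z(\iota_1)|\ge u\}\le 2\exp\left(-\frac{u^2}{2\,d_Z(\iota_0,\iota_1)^2}\right),\qquad \mathbb P\{Z(\iota_0)\ge u\}\le\exp\left(-\frac{u^2}{2}\right),$$ where $d_Z(\iota_0,\iota_1)=\sqrt{\mathbb E(Z(\iota_0)-Z(\iota_1))^2}$ is the canonical distance. $\mathcal N(\mathcal I,d_Z,\epsilon)$ is the minimal number of $d_Z$-balls of radius $\epsilon$ needed to cover $\mathcal I$.
   Formalization: The process is assumed separable for d_Z, the increment bound is required for u > ū_0·d_Z(ι_0,ι_1) instead of u > ū_0, and Γ_0 may depend on ū_0 as well as ρ; the claim is false without these changes. *)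

theory Defs
  imports "HOL-Probability.Probability"
begin

definition canonical_dist :: "'a measure \<Rightarrow> ('i \<Rightarrow> 'a \<Rightarrow> real) \<Rightarrow> 'i \<Rightarrow> 'i \<Rightarrow> real" where
  "canonical_dist M Z i j = sqrt (\<integral>\<omega>. (Z i \<omega> - Z j \<omega>)\<^sup>2 \<partial>M)"

(* Square integrability of the increments makes the canonical distance finite (a Bochner
   integral that does not exist would be 0).

   The threshold ubar is read in standardized units: an increment of standard deviation d obeys
   its tail bound at levels u > ubar * d, and Z i, whose proxy standard deviation is 1, at levels
   u > ubar. With the unscaled threshold u > ubar for the increments too, increments of size at
   most ubar would be unconstrained at every scale, and the maximal inequality would fail.

   When the distance of i and j is 0, HOL's division makes the right-hand side of the increment
   bound equal to 2. Nothing is lost, since Z i = Z j almost surely in that case. *)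
definition standard_subgaussian ::
    "real \<Rightarrow> 'a measure \<Rightarrow> 'i set \<Rightarrow> ('i \<Rightarrow> 'a \<Rightarrow> real) \<Rightarrow> bool" where
  "standard_subgaussian ubar M I Z \<longleftrightarrow>
     prob_space M \<and>
     (\<forall>i\<in>I. integrable M (Z i) \<and> (\<integral>\<omega>. Z i \<omega> \<partial>M) = 0) \<and>
     (\<forall>i\<in>I. \<forall>j\<in>I. integrable M (\<lambda>\<omega>. (Z i \<omega> - Z j \<omega>)\<^sup>2)) \<and>
     (\<forall>i\<in>I. \<forall>j\<in>I. \<forall>u > ubar * canonical_dist M Z i j.
        measure M {\<omega> \<in> space M. \<bar>Z i \<omega> - Z j \<omega>\<bar> \<ge> u}
          \<le> 2 * exp (- (u\<^sup>2 / (2 * (canonical_dist M Z i j)\<^sup>2)))) \<and>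
     (\<forall>i\<in>I. \<forall>u > ubar.
        measure M {\<omega> \<in> space M. Z i \<omega> \<ge> u} \<le> exp (- (u\<^sup>2 / 2)))"

(* Doob separability with respect to the canonical distance. It is the usual convention that
   makes the supremum over an uncountable index set measurable up to a null set and
   independent of the choice of version. Every countable index set satisfies it. *)
definition separable_field :: "'a measure \<Rightarrow> 'i set \<Rightarrow> ('i \<Rightarrow> 'a \<Rightarrow> real) \<Rightarrow> bool" where
  "separable_field M I Z \<longleftrightarrow>
     (\<exists>T N. countable T \<and> T \<subseteq> I \<and> N \<in> null_sets M \<and>
        (\<forall>\<omega> \<in> space M - N. \<forall>i\<in>I. \<forall>\<delta>>0. \<exists>t\<in>T.
           canonical_dist M Z i t < \<delta> \<and> \<bar>Z i \<omega> - Z t \<omega>\<bar> < \<delta>))"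

(* Closed balls centred in I. The value is \<infinity> when no finite cover exists. *)
definition covering_number :: "'i set \<Rightarrow> ('i \<Rightarrow> 'i \<Rightarrow> real) \<Rightarrow> real \<Rightarrow> enat" where
  "covering_number I d \<epsilon> =
     Inf {enat (card C) | C. finite C \<and> C \<subseteq> I \<and> (\<forall>i\<in>I. \<exists>c\<in>C. d c i \<le> \<epsilon>)}"

end

theory Submission
  imports Defs
begin

text \<open>
  Write \<open>L = ln \<Gamma>\<close>. A net of radius \<open>1 / L\<close> has at most \<open>\<Gamma> L\<^sup>\<rho>\<close> points, so a union bound
  controls its maximum at the level \<open>sqrt (2 V)\<close> with \<open>V = L + \<rho> ln L + u + 2\<close>. The remaining
  increments are chained along nets of radii \<open>4\<^sup>-\<^sup>k / L\<close>, with the increment of the \<open>k\<close>-th link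
  bounded by \<open>sqrt (2 V) b 2\<^sup>-\<^sup>k / L\<close> for a constant \<open>b\<close>: the radii are so small that this costs only
  \<open>2 b sqrt (2 V) / L\<close> in total, which is of the order \<open>1 / sqrt L\<close>. Finally
  \<open>sqrt (L V) \<le> (L + V) / 2\<close>.
\<close>

section \<open>Covering nets, increment tails and separability\<close>

lemma covering_number_leD:
  assumes "ereal_of_enat (covering_number I d \<epsilon>) \<le> ereal r"
  obtains C where "finite C" "C \<subseteq> I" "\<And>i. i \<in> I \<Longrightarrow> \<exists>c\<in>C. d c i \<le> \<epsilon>" "real (card C) \<le> r"
proof -
  let ?A = "{enat (card C) | C. finite C \<and> C \<subseteq> I \<and> (\<forall>i\<in>I. \<exists>c\<in>C. d c i \<le> \<epsilon>)}"
  \<comment> \<open>An infimum over the empty set is \<infinity>, which no real bound permits. A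
    nonempty set of \<open>enat\<close> values attains its infimum, so an optimal net
    exists.\<close>
  have ne: "?A \<noteq> {}"
  proof
    assume "?A = {}"
    then have "covering_number I d \<epsilon> = \<infinity>"
      unfolding covering_number_def by (simp only: Inf_enat_def) simp
    then show False
      using assms by simp
  qed
  have "covering_number I d \<epsilon> \<in> ?A"
    unfolding covering_number_def using ne by (meson ex_in_conv wellorder_InfI)
  then obtain C where "covering_number I d \<epsilon> = enat (card C)" "finite C" "C \<subseteq> I"
      "\<forall>i\<in>I. \<exists>c\<in>C. d c i \<le> \<epsilon>"
    by auto
  then show thesis
    using assms by (intro that[of C]) auto
qed

lemma standard_subgaussian_borel_measurable:
  assumes "standard_subgaussian ubar M I Z" "i \<in> I"
  shows "Z i \<in> borel_measurable M"
  using assms unfolding standard_subgaussian_def by (auto intro: borel_measurable_integrable)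

text \<open>Replaces the exact distance by an upper bound, as chaining knows only the radius of a
  net. For positive distance the level only grows relative to the standard deviation. At distance 0
  the defining bound is the vacuous value 2, but the increment then vanishes almost surely because
  its square has integral 0.\<close>

lemma standard_subgaussian_increment_tail:
  assumes sg: "standard_subgaussian ubar M I Z" and ij: "i \<in> I" "j \<in> I"
    and le: "canonical_dist M Z i j \<le> \<epsilon>" and pos: "0 < \<epsilon>" "0 < y" and y: "ubar < y"
  shows "measure M {\<omega> \<in> space M. y * \<epsilon> \<le> \<bar>Z i \<omega> - Z j \<omega>\<bar>} \<le> 2 * exp (- (y\<^sup>2 / 2))"
proof -
  define d where "d = canonical_dist M Z i j"
  have int: "integrable M (\<lambda>\<omega>. (Z i \<omega> - Z j \<omega>)\<^sup>2)"
    using sg ij unfolding standard_subgaussian_def by blast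
  have meas: "Z i \<in> borel_measurable M" "Z j \<in> borel_measurable M"
    using standard_subgaussian_borel_measurable[OF sg] ij by auto
  have nonneg: "0 \<le> d"
    unfolding d_def canonical_dist_def by simp
  show ?thesis
  proof (cases "d = 0")
    case True
    then have "(\<integral>\<omega>. (Z i \<omega> - Z j \<omega>)\<^sup>2 \<partial>M) = 0"
      unfolding d_def canonical_dist_def by simp
    then have "AE \<omega> in M. (Z i \<omega> - Z j \<omega>)\<^sup>2 = 0"
      using integral_nonneg_eq_0_iff_AE[OF int] by simp
    then have "AE \<omega> in M. \<not> y * \<epsilon> \<le> \<bar>Z i \<omega> - Z j \<omega>\<bar>"
      using pos by (auto elim!: eventually_mono simp: not_le)
    then have "measure M {\<omega> \<in> space M. y * \<epsilon> \<le> \<bar>Z i \<omega> - Z j \<omega>\<bar>} = 0"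
      using meas by (intro measure_eq_0_null_sets) (simp add: AE_iff_null)
    then show ?thesis
      by simp
  next
    case False
    then have d: "0 < d" "d \<le> \<epsilon>"
      using nonneg le by (auto simp: d_def)
    have "ubar * d < y * d"
      using y d by simp
    also have "y * d \<le> y * \<epsilon>"
      using d pos by simp
    finally have "measure M {\<omega> \<in> space M. y * \<epsilon> \<le> \<bar>Z i \<omega> - Z j \<omega>\<bar>}
        \<le> 2 * exp (- ((y * \<epsilon>)\<^sup>2 / (2 * d\<^sup>2)))"
      using sg ij unfolding standard_subgaussian_def d_def by blast
    also have "\<dots> \<le> 2 * exp (- (y\<^sup>2 / 2))"
    proof -
      have "y\<^sup>2 * d\<^sup>2 \<le> y\<^sup>2 * \<epsilon>\<^sup>2"
        using d by (intro mult_left_mono power_mono) auto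
      then have "y\<^sup>2 / 2 \<le> (y * \<epsilon>)\<^sup>2 / (2 * d\<^sup>2)"
        using d by (simp add: field_simps power_mult_distrib)
      then show ?thesis
        by simp
    qed
    finally show ?thesis .
  qed
qed

text \<open>Reduces the supremum to a countable one, which is measurable: off \<open>N\<close> every
  value on \<open>I\<close> is a limit of values on \<open>T\<close>.\<close>

lemma separable_fieldE:
  fixes Z :: "'i \<Rightarrow> 'a \<Rightarrow> real"
  assumes "separable_field M I Z"
  obtains T N where "countable T" "T \<subseteq> I" "N \<in> null_sets M"
    "\<And>\<omega>. \<omega> \<in> space M - N \<Longrightarrow> (SUP i\<in>I. ereal (Z i \<omega>)) = (SUP t\<in>T. ereal (Z t \<omega>))"
proof -
  obtain T N where T: "countable T" "T \<subseteq> I" "N \<in> null_sets M"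
    and sep: "\<forall>\<omega> \<in> space M - N. \<forall>i\<in>I. \<forall>\<delta>>0. \<exists>t\<in>T.
      canonical_dist M Z i t < \<delta> \<and> \<bar>Z i \<omega> - Z t \<omega>\<bar> < \<delta>"
    using assms unfolding separable_field_def by (elim exE conjE)
  have "(SUP i\<in>I. ereal (Z i \<omega>)) = (SUP t\<in>T. ereal (Z t \<omega>))" if \<omega>: "\<omega> \<in> space M - N" for \<omega>
  proof (rule antisym)
    show "(SUP t\<in>T. ereal (Z t \<omega>)) \<le> (SUP i\<in>I. ereal (Z i \<omega>))"
      using T(2) by (rule SUP_subset_mono) simp
    show "(SUP i\<in>I. ereal (Z i \<omega>)) \<le> (SUP t\<in>T. ereal (Z t \<omega>))"
    proof (rule SUP_least)
      fix i assume i: "i \<in> I"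
      show "ereal (Z i \<omega>) \<le> (SUP t\<in>T. ereal (Z t \<omega>))"
      proof (rule ereal_le_epsilon2)
        fix \<delta> :: real assume "0 < \<delta>"
        then obtain t where t: "t \<in> T" "\<bar>Z i \<omega> - Z t \<omega>\<bar> < \<delta>"
          using sep \<omega> i by meson
        then have "ereal (Z i \<omega>) \<le> ereal (Z t \<omega>) + ereal \<delta>"
          by simp
        also have "\<dots> \<le> (SUP t\<in>T. ereal (Z t \<omega>)) + ereal \<delta>"
          using t(1) by (intro add_right_mono SUP_upper)
        finally show "ereal (Z i \<omega>) \<le> (SUP t\<in>T. ereal (Z t \<omega>)) + ereal \<delta>" .
      qed
    qed
  qed
  with T show thesis
    by (rule that)
qed

section \<open>Chaining along the nets\<close>

lemma chaining_bound:
  fixes z :: "'i \<Rightarrow> real"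
  assumes "\<And>t. t \<in> S 0 \<Longrightarrow> z t \<le> x"
    and "\<And>k t. t \<in> S (Suc k) \<Longrightarrow> p k t \<in> S k \<and> \<bar>z t - z (p k t)\<bar> \<le> r k"
    and "t \<in> S n"
  shows "z t \<le> x + (\<Sum>k<n. r k)"
  using assms(3)
proof (induction n arbitrary: t)
  case 0
  then show ?case
    using assms(1) by simp
next
  case (Suc n)
  then have "p n t \<in> S n" "\<bar>z t - z (p n t)\<bar> \<le> r n"
    using assms(2) by auto
  with Suc.IH[of "p n t"] show ?case
    by simp
qed

lemma (in finite_measure) measure_UNION_le_card:
  assumes "finite S" "\<And>t. t \<in> S \<Longrightarrow> A t \<in> sets M" "\<And>t. t \<in> S \<Longrightarrow> measure M (A t) \<le> q"
    and "real (card S) \<le> n" "0 \<le> q"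
  shows "measure M (\<Union>t\<in>S. A t) \<le> n * q"
proof -
  have "measure M (\<Union>t\<in>S. A t) \<le> (\<Sum>t\<in>S. measure M (A t))"
    using assms by (intro finite_measure_subadditive_finite) auto
  also have "\<dots> \<le> real (card S) * q"
    using assms(3) by (rule sum_bounded_above)
  also have "\<dots> \<le> n * q"
    using assms by (intro mult_right_mono)
  finally show ?thesis .
qed

lemma sum_half_powers_le: "(\<Sum>k<n. (1 / 2) ^ k) \<le> (2 :: real)"
  by (simp add: sum_gp_strict)

text \<open>Here \<open>L\<close> plays the part of \<open>ln \<Gamma>\<close>. The exceptional
  event is supplied as a set \<open>B\<close> outside which one bound holds for all points of
  \<open>T\<close> at once, so the supremum over \<open>T\<close> is bounded pointwise.\<close>

lemma standard_subgaussian_sup_tail: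
  fixes Z :: "'i \<Rightarrow> 'a \<Rightarrow> real"
  assumes sg: "standard_subgaussian ubar M I Z" and T: "countable T" "T \<subseteq> I"
    and \<rho>: "0 < \<rho>" and L: "1 \<le> L" "ubar\<^sup>2 \<le> L" and u: "0 < u"
    and cov: "\<And>\<epsilon>. 0 < \<epsilon> \<Longrightarrow> \<epsilon> \<le> 1 \<Longrightarrow>
      ereal_of_enat (covering_number I (canonical_dist M Z) \<epsilon>) \<le> ereal (exp L * \<epsilon> powr (- \<rho>))"
  defines "V \<equiv> L + \<rho> * ln L + u + 2"
  obtains B where "B \<in> sets M" "measure M B \<le> exp (- u)"
    "\<And>\<omega> t. \<lbrakk>\<omega> \<in> space M - B; t \<in> T\<rbrakk> \<Longrightarrow> Z t \<omega> \<le> sqrt (2 * V) * (1 + 2 * (2 * \<rho> + 3) / L)"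
proof -
  interpret prob_space M
    using sg unfolding standard_subgaussian_def by blast
  \<comment> \<open>Read \<open>b\<close> as \<open>1 + (2 * \<rho> + 2)\<close>: 1 for the term
    \<open>V\<close>, \<open>2 * \<rho> + 1\<close> for the growth rate of the sets
    \<open>S k\<close>, and 1 for the geometric decay that makes the link probabilities
    summable.\<close>
  define b where "b = 2 * \<rho> + 3"
  define \<epsilon> where "\<epsilon> k = (1 / 4) ^ k / L" for k :: nat
  define x where "x = sqrt (2 * V)"
  \<comment> \<open>The levels double while the radii shrink by 4: the tails beat the net sizes, and
    the bounds \<open>y k * \<epsilon> k\<close> still decay like
    \<open>(1 / 2) ^ k\<close>.\<close>
  define y where "y k = x * b * 2 ^ k" for k :: nat
  have "0 \<le> \<rho> * ln L"
    using \<rho> L by simp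
  then have V: "1 \<le> V" "ubar\<^sup>2 < 2 * V"
    using L u by (auto simp: V_def)
  have x: "0 < x" "ubar < x" "x\<^sup>2 = 2 * V"
    using V real_less_rsqrt[of ubar] by (auto simp: x_def)
  have b: "3 < b"
    using \<rho> by (simp add: b_def)
  have \<epsilon>: "0 < \<epsilon> k" "\<epsilon> k \<le> 1" for k
    using L power_le_one[of "1 / 4 :: real" k] by (auto simp: \<epsilon>_def divide_le_eq_1)
  \<comment> \<open>Since \<open>ubar < x\<close>, this puts every link level above the threshold of
    the increment tail.\<close>
  have xy: "x \<le> y k" for k
  proof -
    have "x * 1 \<le> x * (b * 2 ^ k)"
      using x b mult_mono[of 1 b 1 "2 ^ k"] by (intro mult_left_mono) auto
    then show ?thesis
      by (simp add: y_def mult.assoc)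
  qed
  have \<epsilon>_powr: "exp L * \<epsilon> k powr (- \<rho>) \<le> exp (L + \<rho> * ln L + 2 * \<rho> * real k)" for k
  proof -
    have ln_\<epsilon>: "ln (\<epsilon> k) = - real k * ln 4 - ln L"
      using L by (simp add: \<epsilon>_def ln_div ln_realpow)
    have "ln (4 :: real) \<le> 2"
    proof -
      have "(4 :: real) \<le> exp 1 ^ 2"
        using exp_ge_add_one_self[of 1] power_mono[of 2 "exp 1 :: real" 2] by simp
      then have "ln 4 \<le> ln (exp (2 :: real))"
        by (subst ln_le_cancel_iff) (auto simp flip: exp_of_nat_mult)
      then show ?thesis
        by simp
    qed
    then have "\<rho> * (real k * ln 4) \<le> \<rho> * (real k * 2)"
      using \<rho> by (intro mult_left_mono) auto
    moreover have "- \<rho> * ln (\<epsilon> k) = \<rho> * (real k * ln 4) + \<rho> * ln L"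
      unfolding ln_\<epsilon> by (simp add: algebra_simps)
    ultimately have "- \<rho> * ln (\<epsilon> k) \<le> \<rho> * ln L + 2 * \<rho> * real k"
      by (simp add: algebra_simps)
    then show ?thesis
      using \<epsilon>(1)[of k] by (simp add: powr_def flip: exp_add)
  qed
  have "\<exists>C. finite C \<and> C \<subseteq> I \<and> (\<forall>i\<in>I. \<exists>c\<in>C. canonical_dist M Z c i \<le> \<epsilon> k)
      \<and> real (card C) \<le> exp (L + \<rho> * ln L + 2 * \<rho> * real k)" for k
  proof -
    obtain C where "finite C" "C \<subseteq> I" "\<And>i. i \<in> I \<Longrightarrow> \<exists>c\<in>C. canonical_dist M Z c i \<le> \<epsilon> k"
      "real (card C) \<le> exp L * \<epsilon> k powr (- \<rho>)"
      using covering_number_leD[OF cov[OF \<epsilon>]] by blast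
    then show ?thesis
      using \<epsilon>_powr[of k] by (intro exI[of _ C]) auto
  qed
  from choice[OF allI[OF this]] obtain C where
    "\<forall>k. finite (C k) \<and> C k \<subseteq> I \<and> (\<forall>i\<in>I. \<exists>c\<in>C k. canonical_dist M Z c i \<le> \<epsilon> k)
      \<and> real (card (C k)) \<le> exp (L + \<rho> * ln L + 2 * \<rho> * real k)"
    by (rule exE)
  then have C: "\<And>k. finite (C k)" "\<And>k. C k \<subseteq> I"
    and C_cover: "\<And>k i. i \<in> I \<Longrightarrow> \<exists>c\<in>C k. canonical_dist M Z c i \<le> \<epsilon> k"
    and C_card: "\<And>k. real (card (C k)) \<le> exp (L + \<rho> * ln L + 2 * \<rho> * real k)"
    by blast+
  define p where "p k i = (SOME c. c \<in> C k \<and> canonical_dist M Z c i \<le> \<epsilon> k)" for k i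
  have p: "p k i \<in> C k \<and> canonical_dist M Z (p k i) i \<le> \<epsilon> k" if "i \<in> I" for k i
    unfolding p_def using C_cover[OF that, of k, unfolded Bex_def] by (rule someI_ex)
  \<comment> \<open>Adding the first \<open>k\<close> points of \<open>T\<close> to the \<open>k\<close>-th net makes every chain finite, so that no
    almost sure convergence along the nets is needed.\<close>
  define S where "S k = C k \<union> {t \<in> T. to_nat_on T t < k}" for k
  have fin_idx: "finite {t \<in> T. to_nat_on T t < k}"
    and card_idx: "card {t \<in> T. to_nat_on T t < k} \<le> k" for k
  proof -
    have inj: "inj_on (to_nat_on T) {t \<in> T. to_nat_on T t < k}"
      using inj_on_to_nat_on[OF T(1)] by (rule inj_on_subset) auto
    have sub: "to_nat_on T ` {t \<in> T. to_nat_on T t < k} \<subseteq> {..<k}"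
      by auto
    show "finite {t \<in> T. to_nat_on T t < k}"
      using inj_on_finite[OF inj sub] by simp
    show "card {t \<in> T. to_nat_on T t < k} \<le> k"
      using card_inj_on_le[OF inj sub] by simp
  qed
  have S: "finite (S k)" "S k \<subseteq> I" "C k \<subseteq> S k" for k
    using C T fin_idx by (auto simp: S_def)
  have S_card: "real (card (S k)) \<le> exp (L + \<rho> * ln L + (2 * \<rho> + 1) * real k)" for k
  proof -
    let ?e = "exp (L + \<rho> * ln L + 2 * \<rho> * real k)"
    have e: "1 \<le> ?e"
      using L \<rho> by simp
    have "real (card (S k)) \<le> real (card (C k)) + real k"
      using card_Un_le[of "C k" "{t \<in> T. to_nat_on T t < k}"] card_idx[of k]
      unfolding S_def by linarith
    \<comment> \<open>The at most \<open>k\<close> added points cost a factor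
      \<open>1 + real k\<close>, at most \<open>exp (real k)\<close>; this raises the growth rate
      from \<open>2 * \<rho>\<close> to \<open>2 * \<rho> + 1\<close>.\<close>
    also have "\<dots> \<le> ?e + ?e * real k"
      using C_card[of k] e mult_right_mono[OF e, of "real k"] by linarith
    also have "\<dots> = ?e * (1 + real k)"
      by (simp add: algebra_simps)
    also have "\<dots> \<le> ?e * exp (real k)"
      using exp_ge_add_one_self[of "real k"] by (intro mult_left_mono) auto
    also have "\<dots> = exp (L + \<rho> * ln L + (2 * \<rho> + 1) * real k)"
      by (simp add: algebra_simps flip: exp_add)
    finally show ?thesis .
  qed
  define A where "A = (\<Union>t\<in>S 0. {\<omega> \<in> space M. x \<le> Z t \<omega>})"
  \<comment> \<open>Links go down to \<open>p k t\<close> in the genuine net \<open>C k\<close>, so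
    their length is at most \<open>\<epsilon> k\<close> for the added points of \<open>T\<close>
    too.\<close>
  define D where "D k = (\<Union>t\<in>S (Suc k). {\<omega> \<in> space M. y k * \<epsilon> k \<le> \<bar>Z (p k t) \<omega> - Z t \<omega>\<bar>})" for k
  have pI: "p k t \<in> I" if "t \<in> I" for k t
    using p[OF that] C(2) by auto
  note [measurable] = standard_subgaussian_borel_measurable[OF sg]
  have sets_level: "{\<omega> \<in> space M. x \<le> Z t \<omega>} \<in> sets M" if [simp]: "t \<in> I" for t
    by measurable
  have sets_incr: "{\<omega> \<in> space M. y k * \<epsilon> k \<le> \<bar>Z (p k t) \<omega> - Z t \<omega>\<bar>} \<in> sets M"
    if [simp]: "t \<in> I" for k t
  proof -
    have [simp]: "p k t \<in> I"
      by (rule pI) simp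
    show ?thesis
      by measurable
  qed
  have sets_A: "A \<in> sets M"
    unfolding A_def using S by (intro sets.finite_UN sets_level) auto
  have sets_D: "D k \<in> sets M" for k
    unfolding D_def using S by (intro sets.finite_UN sets_incr) auto
  have prob_A: "measure M A \<le> exp (- u - 2)"
  proof -
    have "measure M A \<le> exp (L + \<rho> * ln L) * exp (- V)"
      unfolding A_def
    proof (rule measure_UNION_le_card)
      fix t assume "t \<in> S 0"
      then have t: "t \<in> I"
        using S by auto
      then show "{\<omega> \<in> space M. x \<le> Z t \<omega>} \<in> sets M"
        by (rule sets_level)
      have "measure M {\<omega> \<in> space M. x \<le> Z t \<omega>} \<le> exp (- (x\<^sup>2 / 2))"
        using sg t x unfolding standard_subgaussian_def by blast
      then show "measure M {\<omega> \<in> space M. x \<le> Z t \<omega>} \<le> exp (- V)"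
        using x by simp
    qed (use S S_card[of 0] in auto)
    then show ?thesis
      by (simp add: V_def flip: exp_add)
  qed
  have prob_D: "measure M (D k) \<le> exp (- u - 2) * (1 / 2) ^ k" for k
  proof -
    have "measure M (D k) \<le> exp (L + \<rho> * ln L + (2 * \<rho> + 1) * real (Suc k)) * (2 * exp (- ((y k)\<^sup>2 / 2)))"
      unfolding D_def
    proof (rule measure_UNION_le_card)
      fix t assume "t \<in> S (Suc k)"
      then have t: "t \<in> I"
        using S by blast
      then show "{\<omega> \<in> space M. y k * \<epsilon> k \<le> \<bar>Z (p k t) \<omega> - Z t \<omega>\<bar>} \<in> sets M"
        by (rule sets_incr)
      show "measure M {\<omega> \<in> space M. y k * \<epsilon> k \<le> \<bar>Z (p k t) \<omega> - Z t \<omega>\<bar>} \<le> 2 * exp (- ((y k)\<^sup>2 / 2))"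
        using t pI[OF t] p[OF t] \<epsilon> xy[of k] x
        by (intro standard_subgaussian_increment_tail[OF sg]) auto
    qed (use S S_card[of "Suc k"] in auto)
    also have "\<dots> = 2 * exp (L + \<rho> * ln L + (2 * \<rho> + 1) * real (Suc k) - (y k)\<^sup>2 / 2)"
      by (simp only: diff_conv_add_uminus exp_add mult.left_commute)
    also have "\<dots> \<le> 2 * exp (- u - 2 - real (Suc k))"
    proof -
      \<comment> \<open>The square of \<open>2 ^ k\<close> in \<open>y k\<close> dominates the
        linear growth of the logarithmic net sizes.\<close>
      have "real (Suc k) \<le> 4 ^ k"
        using Bernoulli_inequality[of "3 :: real" k] by simp
      then have "V * (b * real (Suc k)) \<le> V * (b\<^sup>2 * 4 ^ k)"
        using V b by (intro mult_left_mono mult_mono) (auto simp: power2_eq_square)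
      moreover have "(y k)\<^sup>2 = 2 * (V * (b\<^sup>2 * 4 ^ k))"
      proof -
        have "(4 :: real) ^ k = (2 ^ k)\<^sup>2"
          by (simp add: power2_eq_square flip: power_mult_distrib)
        then show ?thesis
          using x by (simp add: y_def power_mult_distrib)
      qed
      moreover have "V + (2 * \<rho> + 2) * real (Suc k) \<le> V * (b * real (Suc k))"
      proof -
        have "V * 1 + 1 * ((2 * \<rho> + 2) * real (Suc k))
            \<le> V * real (Suc k) + V * ((2 * \<rho> + 2) * real (Suc k))"
          using V \<rho> by (intro add_mono mult_left_mono mult_right_mono) auto
        then show ?thesis
          by (simp add: b_def algebra_simps)
      qed
      ultimately have "V + (2 * \<rho> + 2) * real (Suc k) \<le> (y k)\<^sup>2 / 2"
        by simp
      then show ?thesis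
        by (simp add: V_def algebra_simps)
    qed
    also have "\<dots> = exp (- u - 2) * (2 * exp (- 1) ^ Suc k)"
    proof -
      have "exp (- u - 2 - real (Suc k)) = exp (- u - 2) * exp (- real (Suc k))"
        by (simp flip: exp_add)
      also have "exp (- real (Suc k)) = exp (- 1) ^ Suc k"
        using exp_of_nat_mult[of "Suc k" "- 1 :: real"] by simp
      finally show ?thesis
        by simp
    qed
    \<comment> \<open>The factor 2 of the two-sided tail is absorbed by the shift from
      \<open>k\<close> to \<open>Suc k\<close>.\<close>
    also have "\<dots> \<le> exp (- u - 2) * (2 * (1 / 2) ^ Suc k)"
    proof -
      have "exp (- 1) \<le> (1 / 2 :: real)"
        using exp_ge_add_one_self[of 1] by (simp add: exp_minus field_simps)
      then show ?thesis
        by (intro mult_left_mono power_mono) auto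
    qed
    finally show ?thesis
      by simp
  qed
  have sums: "(\<lambda>k. exp (- u - 2) * (1 / 2) ^ k) sums (exp (- u - 2) * 2)"
    using sums_mult[OF geometric_sums[of "1 / 2 :: real"]] by simp
  have "measure M (\<Union>k. D k) \<le> (\<Sum>k. measure M (D k))"
    using sets_D sums prob_D
    by (intro finite_measure_subadditive_countably)
      (auto intro!: summable_comparison_test'[OF sums_summable[OF sums]])
  also have "\<dots> \<le> exp (- u - 2) * 2"
    using sums prob_D
    by (intro sums_le[OF prob_D summable_sums sums] summable_comparison_test'[OF sums_summable[OF sums]]) auto
  finally have "measure M (\<Union>k. D k) \<le> exp (- u - 2) * 2" .
  \<comment> \<open>The base net contributes 1 and the links contribute 2. The summand 2 in
    \<open>V\<close> pays for this factor, as 3 is at most \<open>exp 2\<close>.\<close>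
  then have "measure M (A \<union> (\<Union>k. D k)) \<le> exp (- u - 2) * 3"
    using measure_Un_le[of A M "\<Union>k. D k"] sets_A sets_D prob_A by auto
  also have "\<dots> \<le> exp (- u - 2) * exp 2"
    using exp_ge_add_one_self[of 2] by (intro mult_left_mono) auto
  also have "\<dots> = exp (- u)"
    by (simp flip: exp_add)
  finally have prob: "measure M (A \<union> (\<Union>k. D k)) \<le> exp (- u)" .
  have "Z t \<omega> \<le> x * (1 + 2 * b / L)" if \<omega>: "\<omega> \<in> space M - (A \<union> (\<Union>k. D k))" and t: "t \<in> T" for \<omega> t
  proof -
    \<comment> \<open>The inequality in \<open>S\<close> is strict, so \<open>t\<close> is certain
      to belong to \<open>S\<close> only from the successor of its index on; the chain starts
      there.\<close>
    have "Z t \<omega> \<le> x + (\<Sum>k<Suc (to_nat_on T t). y k * \<epsilon> k)"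
    proof (rule chaining_bound[of S _ _ p])
      show "Z s \<omega> \<le> x" if "s \<in> S 0" for s
        using that \<omega> by (force simp: A_def)
      show "p k s \<in> S k \<and> \<bar>Z s \<omega> - Z (p k s) \<omega>\<bar> \<le> y k * \<epsilon> k" if s: "s \<in> S (Suc k)" for k s
      proof
        show "p k s \<in> S k"
          using s p S by blast
        show "\<bar>Z s \<omega> - Z (p k s) \<omega>\<bar> \<le> y k * \<epsilon> k"
          using s \<omega> by (force simp: D_def abs_minus_commute)
      qed
    qed (use t in \<open>simp add: S_def\<close>)
    also have "(\<Sum>k<Suc (to_nat_on T t). y k * \<epsilon> k)
        = x * b / L * (\<Sum>k<Suc (to_nat_on T t). (1 / 2) ^ k)"
    proof -
      have "y k * \<epsilon> k = x * b / L * (1 / 2) ^ k" for k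
      proof -
        have "y k * \<epsilon> k = x * b / L * (2 ^ k * (1 / 4) ^ k)"
          by (simp add: y_def \<epsilon>_def)
        also have "(2 :: real) ^ k * (1 / 4) ^ k = (2 * (1 / 4)) ^ k"
          by (simp only: power_mult_distrib)
        finally show ?thesis
          by simp
      qed
      then show ?thesis
        by (simp only: sum_distrib_left)
    qed
    also have "\<dots> \<le> x * b / L * 2"
      using x b L by (intro mult_left_mono sum_half_powers_le) auto
    finally show ?thesis
      by (simp add: algebra_simps)
  qed
  with prob show thesis
    using sets_A sets_D by (intro that[of "A \<union> (\<Union>k. D k)"]) (auto simp: x_def b_def)
qed

section \<open>The deterministic level estimate\<close>

text \<open>Explains the constants: the factor \<open>sqrt (L / 2)\<close>, that is
  \<open>c0 = 1 / 2\<close>, turns the difference of roots into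
  \<open>sqrt (L * (L + W)) - L\<close>, at most \<open>W / 2\<close>. The spare factor 2 absorbs
  \<open>1 + 2 * b / L\<close>. Of \<open>(\<rho> + 1) * ln L\<close>, the part
  \<open>\<rho> * ln L\<close> is in \<open>W\<close>, and the other \<open>ln L\<close> covers the
  constant \<open>2 * b + 2\<close>, which equals \<open>4 * \<rho> + 8\<close>.\<close>

lemma sup_level_le:
  fixes \<rho> L u :: real
  assumes \<rho>: "0 < \<rho>" and L: "exp (4 * \<rho> + 8) \<le> L" and u: "0 < u"
  shows "sqrt (L / 2) * (sqrt (2 * (L + \<rho> * ln L + u + 2)) * (1 + 2 * (2 * \<rho> + 3) / L) - sqrt (2 * L))
    - (\<rho> + 1) * ln L \<le> u"
proof -
  define b where "b = 2 * \<rho> + 3"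
  define W where "W = \<rho> * ln L + u + 2"
  have "4 * \<rho> + 9 \<le> L"
    using exp_ge_add_one_self[of "4 * \<rho> + 8"] L by simp
  then have Lb: "0 < L" "2 * b \<le> L" and b: "0 < b"
    using \<rho> by (auto simp: b_def)
  have lnL: "2 * b + 2 \<le> ln L"
    using L Lb(1) by (simp add: b_def ln_ge_iff algebra_simps)
  have W: "0 \<le> W"
    using \<rho> u lnL b by (auto simp: W_def)
  have "sqrt (L / 2) * (sqrt (2 * (L + W)) * (1 + 2 * b / L) - sqrt (2 * L))
      = sqrt (L * (L + W)) * (1 + 2 * b / L) - L"
  proof -
    have "sqrt (L / 2) * sqrt (2 * (L + W)) = sqrt (L * (L + W))"
      by (simp flip: real_sqrt_mult)
    moreover have "sqrt (L / 2) * sqrt (2 * L) = L"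
      using Lb by (simp flip: real_sqrt_mult)
    ultimately show ?thesis
      by (simp add: right_diff_distrib flip: mult.assoc)
  qed
  also have "\<dots> \<le> (L + W / 2) * (1 + 2 * b / L) - L"
    using arith_geo_mean_sqrt[of L "L + W"] Lb W b
    by (intro diff_right_mono mult_right_mono) (auto simp: field_simps)
  also have "\<dots> = W / 2 * (1 + 2 * b / L) + 2 * b"
    using Lb by (simp add: field_simps)
  also have "\<dots> \<le> W / 2 * 2 + 2 * b"
    using Lb W by (intro add_right_mono mult_left_mono) auto
  also have "\<dots> = W + 2 * b"
    by simp
  also have "\<dots> \<le> u + (\<rho> + 1) * ln L"
    using lnL by (simp add: W_def distrib_right)
  finally show ?thesis
    by (simp add: W_def b_def add.assoc)
qed

section \<open>Choice of constants and passage to the completion\<close>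

theorem theorem2:
  fixes \<rho> :: real
  assumes "\<rho> > 0"
  shows "\<exists>u0 c0 a0 :: real. c0 > 0 \<and>
    (\<forall>ubar>0. \<exists>\<Gamma>0>0.
      \<forall>(M :: 'a measure) (I :: 'i set) (Z :: 'i \<Rightarrow> 'a \<Rightarrow> real) (\<Gamma> :: real).
        standard_subgaussian ubar M I Z \<longrightarrow>
        separable_field M I Z \<longrightarrow>
        \<Gamma> \<ge> \<Gamma>0 \<longrightarrow>
        (\<forall>\<epsilon>. 0 < \<epsilon> \<and> \<epsilon> \<le> 1 \<longrightarrow>
           ereal_of_enat (covering_number I (canonical_dist M Z) \<epsilon>)
             \<le> ereal (\<Gamma> * \<epsilon> powr (- \<rho>))) \<longrightarrow>
        (\<forall>u>u0.
           let E = {\<omega> \<in> space M.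
                 ereal (sqrt (c0 * ln \<Gamma>)) *
                   ((SUP i\<in>I. ereal (Z i \<omega>)) - ereal (sqrt (2 * ln \<Gamma>)))
                   - ereal (a0 * ln (ln \<Gamma>)) > ereal u}
           in E \<in> sets (completion M) \<and> measure (completion M) E \<le> exp (- u)))"
proof -
  \<comment> \<open>The lower bound on \<open>\<Gamma>\<close> gives both
    \<open>exp (4 * \<rho> + 8) \<le> ln \<Gamma>\<close> and
    \<open>ubar\<^sup>2 \<le> ln \<Gamma>\<close>. Only this bound involves \<open>ubar\<close>; the
    other constants depend on \<rho> alone.\<close>
  have tail: "let E = {\<omega> \<in> space M.
          ereal (sqrt (1 / 2 * ln \<Gamma>)) * ((SUP i\<in>I. ereal (Z i \<omega>)) - ereal (sqrt (2 * ln \<Gamma>)))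
            - ereal ((\<rho> + 1) * ln (ln \<Gamma>)) > ereal u}
        in E \<in> sets (completion M) \<and> measure (completion M) E \<le> exp (- u)"
    if sg: "standard_subgaussian ubar M I Z" and sep: "separable_field M I Z"
      and \<Gamma>: "exp (exp (4 * \<rho> + 8) + ubar\<^sup>2) \<le> \<Gamma>"
      and cov: "\<forall>\<epsilon>. 0 < \<epsilon> \<and> \<epsilon> \<le> 1 \<longrightarrow>
           ereal_of_enat (covering_number I (canonical_dist M Z) \<epsilon>) \<le> ereal (\<Gamma> * \<epsilon> powr (- \<rho>))"
      and u: "0 < u"
    for ubar u \<Gamma> :: real and M :: "'a measure" and I :: "'i set" and Z :: "'i \<Rightarrow> 'a \<Rightarrow> real"
  proof -
    interpret prob_space M
      using sg unfolding standard_subgaussian_def by blast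
    interpret completion: prob_space "completion M"
      by (rule prob_space_completion)
    define L where "L = ln \<Gamma>"
    have "0 < \<Gamma>"
      using \<Gamma> by (rule less_le_trans[OF exp_gt_zero])
    then have exp_L: "exp L = \<Gamma>" and "exp (4 * \<rho> + 8) + ubar\<^sup>2 \<le> L"
      using \<Gamma> by (auto simp: L_def ln_ge_iff)
    then have L: "exp (4 * \<rho> + 8) \<le> L" "ubar\<^sup>2 \<le> L" "1 \<le> L"
      using assms exp_ge_add_one_self[of "4 * \<rho> + 8"] zero_le_power2[of ubar]
        exp_gt_zero[of "4 * \<rho> + 8"] by linarith+
    define x where "x = sqrt (2 * (L + \<rho> * ln L + u + 2)) * (1 + 2 * (2 * \<rho> + 3) / L)"
    \<comment> \<open>Taken on extended reals, since the supremum may be \<infinity>, or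
      -\<infinity> when \<open>I\<close> is empty; monotonicity of \<open>\<phi>\<close> covers all
      cases.\<close>
    define \<phi> where "\<phi> s = ereal (sqrt (1 / 2 * L)) * (s - ereal (sqrt (2 * L)))
        - ereal ((\<rho> + 1) * ln L)" for s
    have \<phi>_le: "\<phi> s \<le> ereal u" if "s \<le> ereal x" for s
    proof -
      have "\<phi> s \<le> \<phi> (ereal x)"
        unfolding \<phi>_def using that L
        by (intro ereal_minus_mono ereal_mult_left_mono) auto
      also have "\<dots> \<le> ereal u"
        using sup_level_le[OF assms L(1) u] by (simp add: \<phi>_def x_def)
      finally show ?thesis .
    qed
    obtain T N where T: "countable T" "T \<subseteq> I" and N: "N \<in> null_sets M"
      and SUP_T: "\<And>\<omega>. \<omega> \<in> space M - N \<Longrightarrow> (SUP i\<in>I. ereal (Z i \<omega>)) = (SUP t\<in>T. ereal (Z t \<omega>))"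
      using separable_fieldE[OF sep] by metis
    obtain B where B: "B \<in> sets M" "measure M B \<le> exp (- u)"
      and B_bound: "\<And>\<omega> t. \<lbrakk>\<omega> \<in> space M - B; t \<in> T\<rbrakk> \<Longrightarrow> Z t \<omega> \<le> x"
      using standard_subgaussian_sup_tail[OF sg T assms L(3,2) u] cov unfolding exp_L x_def by metis
    define E where "E = {\<omega> \<in> space M. ereal u < \<phi> (SUP i\<in>I. ereal (Z i \<omega>))}"
    define F where "F = {\<omega> \<in> space M. ereal u < \<phi> (SUP t\<in>T. ereal (Z t \<omega>))}"
    have "(\<lambda>\<omega>. SUP t\<in>T. ereal (Z t \<omega>)) \<in> borel_measurable M"
      using T standard_subgaussian_borel_measurable[OF sg] by (intro borel_measurable_SUP) auto
    then have F: "F \<in> sets M"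
      unfolding F_def \<phi>_def by measurable
    \<comment> \<open>\<open>E\<close> and the measurable \<open>F\<close> agree off
      \<open>N\<close>. Inside \<open>N\<close> the event \<open>E\<close> is an arbitrary subset of
      a null set, measurable only after completion.\<close>
    have "E \<inter> N \<in> null_sets (completion M)"
      by (rule null_sets_completion_subset[OF Int_lower2 null_sets_completionI[OF N]])
    then have "(F - N) \<union> (E \<inter> N) \<in> sets (completion M)"
      using F N by (intro sets.Un) (auto intro: sets_completionI_sets)
    also have "(F - N) \<union> (E \<inter> N) = E"
      using SUP_T by (auto simp: E_def F_def)
    finally have E: "E \<in> sets (completion M)" .
    have "E \<subseteq> B \<union> N"
    proof
      fix \<omega> assume \<omega>: "\<omega> \<in> E"
      show "\<omega> \<in> B \<union> N"
      proof (rule ccontr)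
        assume "\<omega> \<notin> B \<union> N"
        with \<omega> have "\<omega> \<in> space M - B" "\<omega> \<in> space M - N"
          by (auto simp: E_def)
        then have "(SUP i\<in>I. ereal (Z i \<omega>)) \<le> ereal x"
          using B_bound by (auto simp: SUP_T intro!: SUP_least)
        then show False
          using \<phi>_le \<omega> by (auto simp: E_def not_less[symmetric])
      qed
    qed
    then have "measure (completion M) E \<le> measure (completion M) (B \<union> N)"
      using B N by (intro completion.finite_measure_mono) auto
    also have "\<dots> = measure M B"
      using measure_Un_null_set[OF B(1) N] measure_completion[OF sets.Un[OF B(1) null_setsD2[OF N]]]
      by simp
    finally have "measure (completion M) E \<le> exp (- u)"
      using B by simp
    with E show ?thesis
      unfolding E_def \<phi>_def L_def Let_def by (rule conjI)
  qed
  let "\<exists>u0 c0 a0 :: real. 0 < c0 \<and> (\<forall>ubar>0. \<exists>\<Gamma>0>0. ?P u0 c0 a0 ubar \<Gamma>0)" = ?thesis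
  have P: "?P 0 (1 / 2) (\<rho> + 1) ubar (exp (exp (4 * \<rho> + 8) + ubar\<^sup>2))" for ubar
    by (intro allI impI) (rule tail)
  show ?thesis
  proof (rule exI[of _ 0], rule exI[of _ "1 / 2"], rule exI[of _ "\<rho> + 1"], intro conjI allI impI)
    show "(0 :: real) < 1 / 2"
      by simp
    show "\<exists>\<Gamma>0>0. ?P 0 (1 / 2) (\<rho> + 1) ubar \<Gamma>0" for ubar
      by (rule exI[of _ "exp (exp (4 * \<rho> + 8) + ubar\<^sup>2)"], rule conjI[OF exp_gt_zero P])
  qed
qed

end
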